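(* The following three statements hold. (1) Let $n\in\mathbb{Z}_{\ge 0}$ and $a,k,r\in\mathbb{N}$. For any prime $p$, we have $$c_{a,k,r}(p^{\alpha+1}n+p^{\alpha}\beta)\equiv 0\pmod{p^{v_p(k)-\alpha}}$$ for all integers $\alpha,\beta$ with $0\le\alpha\le v_p(\gcd(k,r))-1$ and $1\le\beta\le p-1$. (2) Let $n\in\mathbb{Z}_{\ge 0}$ and $a,k,r,s\in\mathbb{N}$. For any prime $p$, we have $$d_{a,k,r,s}(p^{\alpha+1}n+p^{\alpha}\beta)\equiv 0\pmod{p^{v_p(k)-\alpha}}$$ for all integers $\alpha,\beta$ with $0\le\alpha\le v_p(\gcd(k,r,s))-1$ and $1\le\beta\le p-1$. (3) Let $a,k,n\in\mathbb{N}$ and let $r,s$ be odd positive integers. Then $$d_{a,k,r,s}(2n-1)\equiv 0\pmod{2^{v_2(k)}}.$$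
   Context: $\mathbb{N}$ denotes the positive integers, and $v_p(n)$ denotes the $p$-adic valuation of $n$. For $a,k,r,s\in\mathbb{N}$, the integers $c_{a,k,r}(n)$ and $d_{a,k,r,s}(n)$ ($n\ge 1$) are the coefficients of the following formal power series in $q$, where the sums run over integers $n_1,\dots,n_a$: $$\sum_{n\ge 1}c_{a,k,r}(n)q^n=\sum_{1\le n_1<\cdots<n_a}\frac{q^{r(n_1+\cdots+n_a)}}{(1-q^{n_1})^k\cdots(1-q^{n_a})^k},$$ $$\sum_{n\ge 1}d_{a,k,r,s}(n)q^n=\sum_{1\le n_1<\cdots<n_a}\frac{q^{r(n_1^2+\cdots+n_a^2)+s(n_1+\cdots+n_a)}}{(1-q^{n_1})^k\cdots(1-q^{n_a})^k}.$$ *)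

theory Defs
  imports "HOL-Analysis.Infinite_Sum" "HOL-Number_Theory.Cong"
begin

definition increasing_tuples :: "nat \<Rightarrow> nat list set" where
  "increasing_tuples a = {ns. length ns = a \<and> sorted_wrt (<) ns \<and> (\<forall>n\<in>set ns. 1 \<le> n)}"

text \<open>
  The type \<^typ>\<open>int\<close> has no \<open>inverse\<close> operation, so \<open>/\<close> is not available for formal power series
  over it. For a series \<open>g\<close> with constant coefficient \<open>1\<close>, its reciprocal is
  \<open>fps_right_inverse g 1\<close>, where the second argument is the inverse of the constant coefficient.
\<close>
definition fps_quot :: "int fps \<Rightarrow> int fps \<Rightarrow> int fps" where
  "fps_quot f g = f * fps_right_inverse g 1"

definition c_coeff :: "nat \<Rightarrow> nat \<Rightarrow> nat \<Rightarrow> nat \<Rightarrow> int" where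
  "c_coeff a k r n =
     fps_nth (\<Sum>\<^sub>\<infinity>ns\<in>increasing_tuples a.
       fps_quot (fps_X ^ (r * (\<Sum>m\<leftarrow>ns. m))) (\<Prod>m\<leftarrow>ns. (1 - fps_X ^ m) ^ k)) n"

definition d_coeff :: "nat \<Rightarrow> nat \<Rightarrow> nat \<Rightarrow> nat \<Rightarrow> nat \<Rightarrow> int" where
  "d_coeff a k r s n =
     fps_nth (\<Sum>\<^sub>\<infinity>ns\<in>increasing_tuples a.
       fps_quot (fps_X ^ (r * (\<Sum>m\<leftarrow>ns. m\<^sup>2) + s * (\<Sum>m\<leftarrow>ns. m))) (\<Prod>m\<leftarrow>ns. (1 - fps_X ^ m) ^ k)) n"

text \<open>
  The quotients are genuine and the infinite sums converge in the topology of formal power series,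
  so neither definition falls back on a default value.
\<close>
lemma fps_quot_mult:
  assumes "fps_nth g 0 = 1"
  shows "fps_quot f g * g = f"
proof -
  have "g * fps_right_inverse g 1 = 1"
    by (rule fps_right_inverse) (use assms in simp)
  then show ?thesis
    by (simp add: fps_quot_def mult.assoc mult.commute[of _ g])
qed

lemma denominator_nth_0:
  assumes "ns \<in> increasing_tuples a"
  shows "fps_nth (\<Prod>m\<leftarrow>ns. (1 - fps_X ^ m :: int fps) ^ k) 0 = 1"
proof -
  have "\<forall>n\<in>set ns. 1 \<le> n" using assms by (simp add: increasing_tuples_def)
  then show ?thesis
    by (induction ns) (auto simp: fps_power_zeroth power_0_left)
qed

lemma summable_increasing_tuples:
  assumes "\<And>ns m. m \<in> set ns \<Longrightarrow> m \<le> e ns"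
  shows "(\<lambda>ns. fps_quot (fps_X ^ e ns) (F ns)) summable_on increasing_tuples a"
proof -
  have "finite {ns \<in> increasing_tuples a. fps_nth (fps_quot (fps_X ^ e ns) (F ns)) n \<noteq> 0}" for n
  proof (rule finite_subset)
    show "{ns \<in> increasing_tuples a. fps_nth (fps_quot (fps_X ^ e ns) (F ns)) n \<noteq> 0}
          \<subseteq> {ns. set ns \<subseteq> {..n} \<and> length ns = a}"
    proof safe
      fix ns m
      assume *: "fps_nth (fps_quot (fps_X ^ e ns) (F ns)) n \<noteq> 0" and m: "m \<in> set ns"
      have "e ns \<le> n"
        using * by (auto simp: fps_quot_def fps_X_power_mult_nth split: if_splits)
      then show "m \<le> n" using assms[OF m] by simp
    qed (simp add: increasing_tuples_def)
    show "finite {ns. set ns \<subseteq> {..n} \<and> length ns = a}"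
      by (rule finite_lists_length_eq) simp
  qed
  then show ?thesis
    unfolding summable_on_def
    by (intro exI[of _ "Abs_fps (\<lambda>n. \<Sum>ns | ns \<in> increasing_tuples a \<and>
      fps_nth (fps_quot (fps_X ^ e ns) (F ns)) n \<noteq> 0. fps_nth (fps_quot (fps_X ^ e ns) (F ns)) n)"]
      has_sum_fpsI) simp_all
qed

lemma c_summable:
  assumes "r \<ge> 1"
  shows "(\<lambda>ns. fps_quot (fps_X ^ (r * (\<Sum>m\<leftarrow>ns. m))) (\<Prod>m\<leftarrow>ns. (1 - fps_X ^ m) ^ k))
           summable_on increasing_tuples a"
proof (rule summable_increasing_tuples)
  fix ns :: "nat list" and m assume "m \<in> set ns"
  then have "m \<le> (\<Sum>m\<leftarrow>ns. m)" by (simp add: member_le_sum_list)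
  also have "\<dots> \<le> r * (\<Sum>m\<leftarrow>ns. m)" using assms by simp
  finally show "m \<le> r * (\<Sum>m\<leftarrow>ns. m)" .
qed

lemma d_summable:
  assumes "s \<ge> 1"
  shows "(\<lambda>ns. fps_quot (fps_X ^ (r * (\<Sum>m\<leftarrow>ns. m\<^sup>2) + s * (\<Sum>m\<leftarrow>ns. m)))
             (\<Prod>m\<leftarrow>ns. (1 - fps_X ^ m) ^ k))
           summable_on increasing_tuples a"
proof (rule summable_increasing_tuples)
  fix ns :: "nat list" and m assume "m \<in> set ns"
  then have "m \<le> (\<Sum>m\<leftarrow>ns. m)" by (simp add: member_le_sum_list)
  also have "\<dots> \<le> s * (\<Sum>m\<leftarrow>ns. m)" using assms by simp
  finally show "m \<le> r * (\<Sum>m\<leftarrow>ns. m\<^sup>2) + s * (\<Sum>m\<leftarrow>ns. m)" by simp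
qed

end

theory Submission
  imports Defs
begin

text \<open>
  Each summand is \<open>q^e H\<close> with \<open>H = 1/P^k\<close> for an integer power series \<open>P\<close> with constant term 1.
  Since \<open>H' = - k P' P^(k-1) H^2\<close>, the integer \<open>k\<close> divides \<open>m h_m\<close>, where \<open>h_m\<close> is the \<open>m\<close>-th
  coefficient of \<open>H\<close>. If \<open>p^(\<alpha>+1)\<close> divides \<open>e\<close> but not \<open>N\<close>, then it does not divide \<open>m = N - e\<close>
  either, so \<open>p^(v_p(k)-\<alpha>)\<close> divides \<open>h_m\<close>. For odd \<open>r\<close> and \<open>s\<close> the exponents \<open>e\<close> are even,
  because \<open>x^2 + x\<close> is.
\<close>

text \<open>Convergence of formal power series makes the \<open>n\<close>-th coefficient of the
  partial sums eventually constant, so some finite subset \<open>X\<close> already attains the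
  coefficient of the infinite sum.\<close>

lemma dvd_fps_nth_infsum:
  fixes f :: "'a \<Rightarrow> int fps"
  assumes "\<And>x. x \<in> A \<Longrightarrow> d dvd fps_nth (f x) n"
  shows "d dvd fps_nth (infsum f A) n"
proof (cases "f summable_on A")
  case True
  then have "(sum f \<longlongrightarrow> infsum f A) (finite_subsets_at_top A)"
    by (simp add: has_sum_def[symmetric])
  then have "\<forall>\<^sub>F X in finite_subsets_at_top A. fps_nth (sum f X) n = fps_nth (infsum f A) n"
    by (simp add: tendsto_fps_iff)
  moreover have "\<forall>\<^sub>F X in finite_subsets_at_top A. finite X \<and> X \<subseteq> A"
    by (rule eventually_finite_subsets_at_top_weakI) simp
  ultimately have "\<forall>\<^sub>F X in finite_subsets_at_top A.
      finite X \<and> X \<subseteq> A \<and> fps_nth (sum f X) n = fps_nth (infsum f A) n"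
    by eventually_elim simp
  then obtain X where "X \<subseteq> A" and X: "fps_nth (sum f X) n = fps_nth (infsum f A) n"
    using eventually_happens'[OF finite_subsets_at_top_neq_bot] by blast
  then have "d dvd fps_nth (sum f X) n"
    unfolding fps_sum_nth by (intro dvd_sum) (use assms in blast)
  with X show ?thesis by simp
\<comment> \<open>Without summability \<open>infsum\<close> defaults to 0, which every
  \<open>d\<close> divides.\<close>
qed (simp add: infsum_not_exists)

lemma dvd_index_mult_nth_inverse_power:
  fixes P :: "int fps"
  assumes "fps_nth P 0 = 1"
  shows "int k dvd int m * fps_nth (fps_right_inverse (P ^ k) 1) m"
proof (cases m)
  \<comment> \<open>The factor \<open>m\<close> comes from differentiation: coefficient
    \<open>j\<close> of \<open>H'\<close> is \<open>m\<close> times coefficient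
    \<open>m = j + 1\<close> of \<open>H\<close>. For \<open>m = 0\<close> the product
    vanishes.\<close>
  case (Suc j)
  define H where "H = fps_right_inverse (P ^ k) 1"
  have HP: "P ^ k * H = 1"
    unfolding H_def by (rule fps_right_inverse) (simp add: fps_power_zeroth assms)
  then have "fps_deriv (P ^ k * H) = 0" by simp
  then have "P ^ k * fps_deriv H = - (fps_deriv (P ^ k) * H)"
    by (simp add: eq_neg_iff_add_eq_0 add.commute)
  \<comment> \<open>Multiplying by \<open>H\<close> cancels \<open>P ^ k\<close> and so replaces a
    division over the integers.\<close>
  then have "H * (P ^ k * fps_deriv H) = - (H * fps_deriv (P ^ k) * H)"
    by (simp add: algebra_simps)
  moreover have "H * (P ^ k * fps_deriv H) = (P ^ k * H) * fps_deriv H"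
    by (simp only: mult_ac)
  ultimately have "fps_deriv H = - (H * fps_deriv (P ^ k) * H)"
    by (simp add: HP)
  also have "\<dots> = of_nat k * (- (H * (fps_deriv P * P ^ (k - 1)) * H))"
    by (simp add: fps_deriv_power' algebra_simps)
  also have "of_nat k = fps_const (int k)"
    by (simp add: fps_of_nat)
  finally have "int k dvd fps_nth (fps_deriv H) j"
    by (simp add: fps_mult_left_const_nth del: fps_deriv_nth)
  then show ?thesis
    by (simp add: Suc H_def)
qed simp

text \<open>Compare valuations in \<open>k dvd m * h\<close>: \<open>m\<close> contributes at most
  \<open>\<alpha>\<close> factors of \<open>p\<close>, so \<open>h\<close> carries the rest. The
  truncated subtraction makes the claim trivial once \<open>\<alpha>\<close> reaches
  \<open>multiplicity p k\<close>.\<close>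

lemma prime_power_dvd_nth_inverse_power:
  fixes P :: "int fps"
  assumes "fps_nth P 0 = 1" "prime p" "\<not> p ^ (\<alpha> + 1) dvd m"
  shows "int p ^ (multiplicity p k - \<alpha>) dvd fps_nth (fps_right_inverse (P ^ k) 1) m"
proof (cases "fps_nth (fps_right_inverse (P ^ k) 1) m = 0")
  \<comment> \<open>Additivity of \<open>multiplicity\<close> needs nonzero factors, hence the
    separate case of a zero coefficient; \<open>m \<noteq> 0\<close> holds because every power of
    \<open>p\<close> divides 0.\<close>
  case False
  define h where "h = fps_nth (fps_right_inverse (P ^ k) 1) m"
  have p: "prime (int p)" and m: "m \<noteq> 0" and h: "h \<noteq> 0"
    using assms False by (auto simp: h_def intro: ccontr)
  have "p ^ multiplicity p k dvd k" by (rule multiplicity_dvd)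
  then have "int p ^ multiplicity p k dvd int k"
    by (metis of_nat_dvd_iff of_nat_power)
  also have "int k dvd int m * h"
    unfolding h_def by (rule dvd_index_mult_nth_inverse_power) fact
  finally have "multiplicity p k \<le> multiplicity (int p) (int m * h)"
    using p m h by (intro multiplicity_geI) (auto simp: prime_int_iff)
  also have "\<dots> = multiplicity (int p) (int m) + multiplicity (int p) h"
    using p m h by (intro prime_elem_multiplicity_mult_distrib) auto
  also have "multiplicity (int p) (int m) < \<alpha> + 1"
    using assms(3) m \<open>prime p\<close> prime_gt_1_nat[of p]
    by (intro multiplicity_lessI) (auto simp: of_nat_dvd_iff simp del: power_Suc simp flip: of_nat_power)
  finally have "multiplicity p k - \<alpha> \<le> multiplicity (int p) h" by simp
  then show ?thesis
    unfolding h_def[symmetric] by (rule multiplicity_dvd')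
qed simp

text \<open>Keeping the exponent function \<open>e\<close> arbitrary lets one argument serve both
  \<open>c_coeff\<close> and \<open>d_coeff\<close>.\<close>

lemma prime_power_dvd_nth_infsum_quot:
  assumes "prime p" "\<not> p ^ (\<alpha> + 1) dvd N"
    and e: "\<And>ns. ns \<in> increasing_tuples a \<Longrightarrow> p ^ (\<alpha> + 1) dvd e ns"
  shows "int p ^ (multiplicity p k - \<alpha>) dvd
    fps_nth (\<Sum>\<^sub>\<infinity>ns\<in>increasing_tuples a.
      fps_quot (fps_X ^ e ns) (\<Prod>m\<leftarrow>ns. (1 - fps_X ^ m) ^ k)) N"
proof (rule dvd_fps_nth_infsum)
  fix ns assume ns: "ns \<in> increasing_tuples a"
  define P :: "int fps" where "P = (\<Prod>m\<leftarrow>ns. 1 - fps_X ^ m)"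
  have P0: "fps_nth P 0 = 1"
    using denominator_nth_0[OF ns, of 1] by (simp add: P_def)
  have Pk: "(\<Prod>m\<leftarrow>ns. (1 - fps_X ^ m :: int fps) ^ k) = P ^ k"
    by (simp add: P_def prod_list_power o_def)
  \<comment> \<open>For \<open>N < e ns\<close> the coefficient is 0, so only a genuine difference
    has to be treated.\<close>
  have "\<not> p ^ (\<alpha> + 1) dvd N - e ns" if "e ns \<le> N"
    using assms(2) e[OF ns] that by (metis dvd_add le_add_diff_inverse)
  then show "int p ^ (multiplicity p k - \<alpha>) dvd
      fps_nth (fps_quot (fps_X ^ e ns) (\<Prod>m\<leftarrow>ns. (1 - fps_X ^ m) ^ k)) N"
    unfolding Pk fps_quot_def fps_X_power_mult_nth
    using prime_power_dvd_nth_inverse_power[OF P0 \<open>prime p\<close>] by simp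
qed

text \<open>Cancelling \<open>p ^ \<alpha>\<close> would leave \<open>p dvd \<beta>\<close>,
  impossible for \<open>0 < \<beta> < p\<close>.\<close>

lemma not_prime_power_dvd_residue:
  fixes p :: nat
  assumes "prime p" "1 \<le> \<beta>" "\<beta> \<le> p - 1"
  shows "\<not> p ^ (\<alpha> + 1) dvd p ^ (\<alpha> + 1) * n + p ^ \<alpha> * \<beta>"
proof
  assume "p ^ (\<alpha> + 1) dvd p ^ (\<alpha> + 1) * n + p ^ \<alpha> * \<beta>"
  then have "p ^ \<alpha> * p dvd p ^ \<alpha> * \<beta>"
    by (simp add: dvd_add_right_iff mult.commute)
  then have "p dvd \<beta>"
    using assms(1) by (simp add: prime_gt_0_nat)
  then have "p \<le> \<beta>" using assms(2) by (intro dvd_imp_le) auto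
  with assms(2,3) show False by linarith
qed

lemma prime_power_dvd_of_less_multiplicity:
  assumes "int \<alpha> \<le> int (multiplicity p g) - 1"
  shows "p ^ (\<alpha> + 1) dvd g"
  using assms by (intro multiplicity_dvd') linarith

theorem theorem1p2:
  shows
   "(\<forall>(n::nat) (a::nat) (k::nat) (r::nat) (p::nat) (\<alpha>::nat) (\<beta>::nat).
       a \<ge> 1 \<longrightarrow> k \<ge> 1 \<longrightarrow> r \<ge> 1 \<longrightarrow> prime p \<longrightarrow>
       int \<alpha> \<le> int (multiplicity p (gcd k r)) - 1 \<longrightarrow> 1 \<le> \<beta> \<longrightarrow> \<beta> \<le> p - 1 \<longrightarrow>
       [c_coeff a k r (p ^ (\<alpha> + 1) * n + p ^ \<alpha> * \<beta>) = 0] (mod int p ^ (multiplicity p k - \<alpha>)))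
    \<and>
    (\<forall>(n::nat) (a::nat) (k::nat) (r::nat) (s::nat) (p::nat) (\<alpha>::nat) (\<beta>::nat).
       a \<ge> 1 \<longrightarrow> k \<ge> 1 \<longrightarrow> r \<ge> 1 \<longrightarrow> s \<ge> 1 \<longrightarrow> prime p \<longrightarrow>
       int \<alpha> \<le> int (multiplicity p (gcd k (gcd r s))) - 1 \<longrightarrow> 1 \<le> \<beta> \<longrightarrow> \<beta> \<le> p - 1 \<longrightarrow>
       [d_coeff a k r s (p ^ (\<alpha> + 1) * n + p ^ \<alpha> * \<beta>) = 0] (mod int p ^ (multiplicity p k - \<alpha>)))
    \<and>
    (\<forall>(a::nat) (k::nat) (n::nat) (r::nat) (s::nat).
       a \<ge> 1 \<longrightarrow> k \<ge> 1 \<longrightarrow> n \<ge> 1 \<longrightarrow> odd r \<longrightarrow> odd s \<longrightarrow>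
       [d_coeff a k r s (2 * n - 1) = 0] (mod 2 ^ multiplicity 2 k))"
proof (intro conjI allI impI, goal_cases)
  case (1 n a k r p \<alpha> \<beta>)
  have "p ^ (\<alpha> + 1) dvd r"
    using prime_power_dvd_of_less_multiplicity[OF 1(5)] by simp
  then show ?case
    unfolding c_coeff_def cong_0_iff
    by (intro prime_power_dvd_nth_infsum_quot not_prime_power_dvd_residue 1) simp
next
  case (2 n a k r s p \<alpha> \<beta>)
  have "p ^ (\<alpha> + 1) dvd r" "p ^ (\<alpha> + 1) dvd s"
    using prime_power_dvd_of_less_multiplicity[OF 2(6)] by simp_all
  then show ?case
    unfolding d_coeff_def cong_0_iff
    by (intro prime_power_dvd_nth_infsum_quot not_prime_power_dvd_residue 2) simp
next
  case (3 a k n r s)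
  have "even (r * (\<Sum>m\<leftarrow>ns. m\<^sup>2) + s * (\<Sum>m\<leftarrow>ns. m))" for ns :: "nat list"
    by (induction ns) (use 3 in auto)
  \<comment> \<open>The bound \<open>n \<ge> 1\<close> matters here: truncated subtraction gives 0
    at \<open>n = 0\<close>.\<close>
  moreover have "odd (2 * n - 1)" using 3 by simp
  ultimately show ?case
    unfolding d_coeff_def cong_0_iff
    \<comment> \<open>With \<open>p = 2\<close> and \<open>\<alpha> = 0\<close> the divisibility
      conditions are mere parity, and the full power of 2 in \<open>k\<close> survives.\<close>
    using prime_power_dvd_nth_infsum_quot[of 2 0 "2 * n - 1" a] by simp
qed

end
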